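(* Let $G^g,H^h$ be games with activeness. If $G^g$ is canonical and $G^g=H^h$, then $G^g$ is covered by $H^h$.
   Context: Let $\mathcal{B}=\{0,1\}$. Define $\mathbb{I}_0=\{\emptyset\}\times\mathcal{B}$ and $\mathbb{I}_n=2^{\mathbb{I}_{n-1}}\times\mathcal{B}$ for $n\ge1$; a game with activeness is an element of $\mathbb{I}=\bigcup_{n\ge0}\mathbb{I}_n$. A pair $(G,g)$ is written $G^g$; elements of $G$ are its options, $g=1$ meaning active. The outcome $o$ is defined recursively: $o(G^g)=\mathscr{N}$ if $g=1$ and some option has outcome $\mathscr{P}$, and $o(G^g)=\mathscr{P}$ otherwise. The sum is $G^g+H^h=(\{G'^{g'}+H^h:G'^{g'}\in G^g\}\cup\{G^g+H'^{h'}:H'^{h'}\in H^h\})^{\max\{g,h\}}$. $G^g=H^h$ means $o(G^g+X^x)=o(H^h+X^x)$ for all games $X^x$. $G^g$ is covered by $H^h$ if for every option $G'^{g'}$ of $G^g$ there is an option $H'^{h'}$ of $H^h$ with $G'^{g'}=H'^{h'}$. An option $G'^{g'}$ of $G^g$ is reversible if some $G''^{g''}\in G'^{g'}$ satisfies $G''^{g''}=G^g$; a game is canonical (recursively) if all its options are canonical and none of its options is reversible. *)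

theory Defs
  imports "HOL-Library.FSet"
begin

datatype game = Game (options: "game fset") (active: bool)

text \<open>
  The paper's games are the elements of the union of the levels \<open>\<I>\<^sub>0 = {{}} \<times> {0, 1}\<close> and
  \<open>\<I>\<^sub>n = Pow \<I>\<^sub>n\<^sub>-\<^sub>1 \<times> {0, 1}\<close>, transcribed as \<open>game_level\<close>. The levels are finite, so finite option
  sets suffice and the datatype is exactly this union (\<open>Union_game_level\<close>).
\<close>

primrec game_level :: "nat \<Rightarrow> game set" where
  "game_level 0 = {G. options G = {||}}"
| "game_level (Suc n) = {G. fset (options G) \<subseteq> game_level n}"

lemma finite_game_level: "finite (game_level n)"
proof (induction n)
  case 0
  have "game_level 0 \<subseteq> (\<lambda>g. Game {||} g) ` UNIV"
    by (auto simp: image_iff) (metis game.collapse)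
  then show ?case
    by (rule finite_subset) simp
next
  case (Suc n)
  have "game_level (Suc n) \<subseteq> (\<lambda>(A, g). Game (Abs_fset A) g) ` (Pow (game_level n) \<times> UNIV)"
  proof
    fix G assume "G \<in> game_level (Suc n)"
    then have "fset (options G) \<in> Pow (game_level n)" by simp
    moreover have "G = (\<lambda>(A, g). Game (Abs_fset A) g) (fset (options G), active G)"
      by (simp add: fset_inverse)
    ultimately show "G \<in> (\<lambda>(A, g). Game (Abs_fset A) g) ` (Pow (game_level n) \<times> UNIV)"
      by blast
  qed
  then show ?case
    by (rule finite_subset) (simp add: Suc)
qed

lemma game_level_mono_Suc: "game_level n \<subseteq> game_level (Suc n)"
  by (induction n) auto

lemma Union_game_level: "(\<Union>n. game_level n) = UNIV"
proof -
  have mono: "game_level m \<subseteq> game_level n" if "m \<le> n" for m n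
    using game_level_mono_Suc that by (rule lift_Suc_mono_le)
  have "\<exists>n. G \<in> game_level n" for G
  proof (induction G)
    case (Game A g)
    then obtain k where k: "\<And>H. H |\<in>| A \<Longrightarrow> H \<in> game_level (k H)"
      by metis
    have "fset A \<subseteq> game_level (Max (k ` fset A))"
    proof
      fix H assume H: "H \<in> fset A"
      then have "k H \<le> Max (k ` fset A)" by simp
      then show "H \<in> game_level (Max (k ` fset A))"
        using mono k[of H] H by blast
    qed
    then have "Game A g \<in> game_level (Suc (Max (k ` fset A)))" by simp
    then show ?case by blast
  qed
  then show ?thesis by blast
qed

lemma size_option: "H |\<in>| G \<Longrightarrow> size H < size (Game G g)"
proof -
  assume "H |\<in>| G"
  then have "Suc (size H) \<le> (\<Sum>x\<in>fset G. Suc (size x))"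
    by (intro member_le_sum) auto
  then show ?thesis by simp
qed

datatype outcome_class = \<N> | \<P>

function outcome :: "game \<Rightarrow> outcome_class" where
  "outcome (Game G g) = (if g \<and> (\<exists>G' |\<in>| G. outcome G' = \<P>) then \<N> else \<P>)"
  by pat_completeness auto
termination
  by (relation "measure size") (use size_option in auto)

function game_sum :: "game \<Rightarrow> game \<Rightarrow> game" (infixl "\<oplus>" 65) where
  "Game G g \<oplus> Game H h =
     Game ((\<lambda>G'. G' \<oplus> Game H h) |`| G |\<union>| (\<lambda>H'. Game G g \<oplus> H') |`| H) (g \<or> h)"
  by pat_completeness auto
termination
  by (relation "measure (\<lambda>(G, H). size G + size H)") (use size_option in auto)

definition game_eq :: "game \<Rightarrow> game \<Rightarrow> bool" (infix "\<doteq>" 50) where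
  "G \<doteq> H \<longleftrightarrow> (\<forall>X. outcome (G \<oplus> X) = outcome (H \<oplus> X))"

definition covered_by :: "game \<Rightarrow> game \<Rightarrow> bool" where
  "covered_by G H \<longleftrightarrow> (\<forall>G' |\<in>| options G. \<exists>H' |\<in>| options H. G' \<doteq> H')"

definition reversible_option :: "game \<Rightarrow> game \<Rightarrow> bool" where
  "reversible_option G G' \<longleftrightarrow> G' |\<in>| options G \<and> (\<exists>G'' |\<in>| options G'. G'' \<doteq> G)"

function canonical :: "game \<Rightarrow> bool" where
  "canonical (Game G g) \<longleftrightarrow>
     (\<forall>G' |\<in>| G. canonical G') \<and> (\<forall>G' |\<in>| G. \<not> reversible_option (Game G g) G')"
  by pat_completeness auto
termination
  by (relation "measure size") (use size_option in auto)

end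

theory Submission
  imports Defs
begin

text \<open>
  The argument follows Conway's theory of linked games in misere play. Every game \<open>H\<close> has an active
  mate \<open>Y\<close> such that \<open>H \<oplus> Y\<close> is a \<open>\<P>\<close>-position. Adding mates as options to a separating test game
  shows that distinct games can be separated in both directions, by active test games. Hence, if no
  option of \<open>G\<close> equals \<open>H\<close> and no option of \<open>H\<close> equals \<open>G\<close>, one can assemble an active \<open>T\<close> with
  both \<open>G \<oplus> T\<close> and \<open>H \<oplus> T\<close> in \<open>\<P>\<close>. If \<open>G \<doteq> H\<close>, an option \<open>G'\<close> of \<open>G\<close> cannot be linked to \<open>H\<close> in
  this way, as \<open>G' \<oplus> T\<close> is an option of \<open>G \<oplus> T\<close>; so \<open>G'\<close> equals an option of \<open>H\<close> or is reversible.
\<close>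

lemma outcome_eq_P_iff:
  "outcome G = \<P> \<longleftrightarrow> (active G \<longrightarrow> (\<forall>G' |\<in>| options G. outcome G' = \<N>))"
  by (cases G) (auto, (metis outcome_class.exhaust outcome_class.distinct)+)

lemma outcome_eq_N_iff:
  "outcome G = \<N> \<longleftrightarrow> active G \<and> (\<exists>G' |\<in>| options G. outcome G' = \<P>)"
  by (cases G) auto

lemma active_game_sum [simp]: "active (G \<oplus> H) \<longleftrightarrow> active G \<or> active H"
  by (cases G; cases H) simp

lemma options_game_sum:
  "options (G \<oplus> H) = (\<lambda>G'. G' \<oplus> H) |`| options G |\<union>| (\<lambda>H'. G \<oplus> H') |`| options H"
  by (cases G; cases H) simp

lemma outcome_sum_N_left:
  assumes "active X" "G' |\<in>| options G" "outcome (G' \<oplus> X) = \<P>"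
  shows "outcome (G \<oplus> X) = \<N>"
  using assms by (auto simp: outcome_eq_N_iff[of "G \<oplus> X"] options_game_sum)

lemma outcome_sum_N_right:
  assumes "active X" "X' |\<in>| options X" "outcome (G \<oplus> X') = \<P>"
  shows "outcome (G \<oplus> X) = \<N>"
  using assms by (auto simp: outcome_eq_N_iff[of "G \<oplus> X"] options_game_sum)

text \<open>A move to \<open>G'\<close> has a reply inside \<open>X\<close>; the test games below
  are checked this way.\<close>

lemma outcome_sum_P:
  assumes "active X"
    and "\<And>G'. G' |\<in>| options G \<Longrightarrow> \<exists>X' |\<in>| options X. outcome (G' \<oplus> X') = \<P>"
    and "\<And>X'. X' |\<in>| options X \<Longrightarrow> outcome (G \<oplus> X') = \<N>"
  shows "outcome (G \<oplus> X) = \<P>"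
proof -
  have "outcome (G' \<oplus> X) = \<N>" if "G' |\<in>| options G" for G'
    using assms(1) assms(2)[OF that] outcome_sum_N_right by blast
  then show ?thesis
    using assms(3) by (auto simp: outcome_eq_P_iff[of "G \<oplus> X"] options_game_sum)
qed

text \<open>Taking the mates of the options of \<open>H\<close> as options of \<open>Y\<close>, a
  move to \<open>H'\<close> is answered by its mate and vice versa.\<close>

lemma active_mate_exists: "\<exists>Y. active Y \<and> outcome (H \<oplus> Y) = \<P>"
proof (induction H)
  case (Game A h)
  then obtain mate where
    mate: "\<And>H'. H' |\<in>| A \<Longrightarrow> active (mate H') \<and> outcome (H' \<oplus> mate H') = \<P>"
    by metis
  have "outcome (Game A h \<oplus> Game (mate |`| A) True) = \<P>"
    using mate by (intro outcome_sum_P) (auto intro: outcome_sum_N_left)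
  then show ?case
    by (intro exI[of _ "Game (mate |`| A) True"]) simp
qed

text \<open>In the new test game, \<open>T\<close> is the winning move from \<open>G\<close>, while
  the mates answer every move in \<open>H\<close>.\<close>

lemma separation_swap:
  assumes "outcome (G \<oplus> T) = \<P>" "outcome (H \<oplus> T) = \<N>"
  obtains U where "active U" "outcome (G \<oplus> U) = \<N>" "outcome (H \<oplus> U) = \<P>"
proof -
  obtain mate where mate: "\<And>H'. active (mate H') \<and> outcome (H' \<oplus> mate H') = \<P>"
    using active_mate_exists by metis
  let ?U = "Game (finsert T (mate |`| options H)) True"
  have "outcome (G \<oplus> ?U) = \<N>"
    using assms(1) by (intro outcome_sum_N_right[of _ T]) auto
  moreover have "outcome (H \<oplus> ?U) = \<P>"
    using mate assms(2) by (intro outcome_sum_P) (auto intro: outcome_sum_N_left)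
  ultimately show ?thesis
    using that[of ?U] by simp
qed

lemma separation:
  assumes "\<not> G \<doteq> H"
  shows "\<exists>U. active U \<and> outcome (G \<oplus> U) = \<P> \<and> outcome (H \<oplus> U) = \<N>"
proof -
  obtain T where "outcome (G \<oplus> T) \<noteq> outcome (H \<oplus> T)"
    using assms by (auto simp: game_eq_def)
  then consider
      "outcome (G \<oplus> T) = \<P>" "outcome (H \<oplus> T) = \<N>"
    | "outcome (H \<oplus> T) = \<P>" "outcome (G \<oplus> T) = \<N>"
    by (metis outcome_class.exhaust)
  then show ?thesis
  proof cases
    case 1
    \<comment> \<open>\<open>T\<close> may be inactive; swapping twice keeps the direction and
      yields an active test game.\<close>
    then obtain U where "outcome (H \<oplus> U) = \<P>" "outcome (G \<oplus> U) = \<N>"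
      by (rule separation_swap)
    then show ?thesis
      by (metis separation_swap)
  next
    case 2
    then show ?thesis
      by (metis separation_swap)
  qed
qed

lemma game_eq_sym: "G \<doteq> H \<Longrightarrow> H \<doteq> G"
  by (simp add: game_eq_def)

lemma game_eq_trans: "G \<doteq> H \<Longrightarrow> H \<doteq> K \<Longrightarrow> G \<doteq> K"
  by (simp add: game_eq_def)

lemma linked_by_active_game:
  assumes "\<And>G'. G' |\<in>| options G \<Longrightarrow> \<not> G' \<doteq> H"
    and "\<And>H'. H' |\<in>| options H \<Longrightarrow> \<not> H' \<doteq> G"
  obtains T where "active T" "outcome (G \<oplus> T) = \<P>" "outcome (H \<oplus> T) = \<P>"
proof -
  obtain s where s: "\<And>G'. G' |\<in>| options G \<Longrightarrow>
      active (s G') \<and> outcome (G' \<oplus> s G') = \<P> \<and> outcome (H \<oplus> s G') = \<N>"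
    using separation[OF assms(1)] by metis
  obtain t where t: "\<And>H'. H' |\<in>| options H \<Longrightarrow>
      active (t H') \<and> outcome (H' \<oplus> t H') = \<P> \<and> outcome (G \<oplus> t H') = \<N>"
    using separation[OF assms(2)] by metis
  \<comment> \<open>Each separator answers the move it belongs to. Moving to it loses: its own
    option is the reply on one side, separation gives \<open>\<N>\<close> on the other.\<close>
  let ?T = "Game (s |`| options G |\<union>| t |`| options H) True"
  have "outcome (G \<oplus> ?T) = \<P>"
    using s t by (intro outcome_sum_P) (auto intro: outcome_sum_N_left)
  moreover have "outcome (H \<oplus> ?T) = \<P>"
    using s t by (intro outcome_sum_P) (auto intro: outcome_sum_N_left)
  ultimately show ?thesis
    using that[of ?T] by simp
qed

theorem theorem3p41:
  fixes G H :: game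
  assumes "canonical G" and "G \<doteq> H"
  shows "covered_by G H"
  unfolding covered_by_def
proof (intro fBallI, rule ccontr)
  fix G' assume G': "G' |\<in>| options G"
    and uncovered: "\<not> (\<exists>H' |\<in>| options H. G' \<doteq> H')"
  have "\<not> reversible_option G G'"
    using assms(1) G' by (cases G) simp
  \<comment> \<open>An option of \<open>G'\<close> equal to \<open>H\<close> would equal
    \<open>G\<close>, making \<open>G'\<close> reversible.\<close>
  then have "\<not> G'' \<doteq> H" if "G'' |\<in>| options G'" for G''
    using that G' assms(2) game_eq_sym game_eq_trans
    unfolding reversible_option_def by blast
  moreover have "\<not> H' \<doteq> G'" if "H' |\<in>| options H" for H'
    using that uncovered game_eq_sym by blast
  ultimately obtain T where T: "active T" "outcome (G' \<oplus> T) = \<P>" "outcome (H \<oplus> T) = \<P>"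
    using linked_by_active_game by blast
  have "outcome (G \<oplus> T) = \<N>"
    using T(1) G' T(2) by (rule outcome_sum_N_left)
  then show False
    using T(3) assms(2) by (simp add: game_eq_def)
qed

end
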